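(* Let the 4-star be the graph on vertices $s_1,s_2,s_3,s_4$ with edges $s_1s_2$, $s_2s_3$, $s_2s_4$ (so $s_2$ is the center). Let $H$ be the $(s_1,1)$-ordering of the 4-star. Then $R_<(H)=6$.
   Context: A $k$-ordering of a graph $H$ assigns distinct order-labels from $\{1,\ldots,|H|\}$ to $k$ of the vertices of $H$. For a vertex $v$ of $H$ and $1\le l\le |H|$, the $(v,l)$-ordering of $H$ is the 1-ordering in which $v$ receives order-label $l$ and no other vertex is labeled. An ordered 2-coloring on $n$ vertices is a red/blue coloring of the edges of the complete graph on vertex set $\{1,\ldots,n\}$. It contains a $k$-ordering $H$ (in a given color) if it has a subgraph isomorphic to $H$, all of whose edges have that color, such that for every $i$ the $i$-th smallest vertex of the copy corresponds to a vertex of $H$ that has order-label $i$ or no order-label. $R_<(H)$ is the least $n$ such that every ordered 2-coloring on $n$ vertices contains a monochromatic (red or blue) copy of $H$. *)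

theory Defs
  imports Main "HOL-Library.Extended_Nat"
begin

record 'a ugraph =
  verts :: "'a set"
  edges :: "'a set set"

definition finite_simple_graph :: "'a ugraph \<Rightarrow> bool" where
  "finite_simple_graph G \<longleftrightarrow>
     finite (verts G) \<and> (\<forall>e\<in>edges G. e \<subseteq> verts G \<and> card e = 2)"

text \<open>A partially order-labelled graph; \<open>label H v = None\<close> means that \<open>v\<close> carries no order-label.\<close>

record 'a ordering =
  graph :: "'a ugraph"
  label :: "'a \<rightharpoonup> nat"

definition is_k_ordering :: "nat \<Rightarrow> 'a ordering \<Rightarrow> bool" where
  "is_k_ordering k H \<longleftrightarrow>
     finite_simple_graph (graph H) \<and>
     dom (label H) \<subseteq> verts (graph H) \<and> card (dom (label H)) = k \<and>
     inj_on (label H) (dom (label H)) \<and>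
     ran (label H) \<subseteq> {1..card (verts (graph H))}"

definition single_ordering :: "'a ugraph \<Rightarrow> 'a \<Rightarrow> nat \<Rightarrow> 'a ordering" where
  "single_ordering G v l = \<lparr>graph = G, label = [v \<mapsto> l]\<rparr>"

datatype color = Red | Blue

text \<open>An ordered 2-coloring on \<open>n\<close> vertices is a function on vertex sets, of which only the values
  on the two-element subsets of \<open>{1..n}\<close> matter.\<close>

type_synonym edge_coloring = "nat set \<Rightarrow> color"

definition ith_smallest :: "nat set \<Rightarrow> nat \<Rightarrow> nat" where
  "ith_smallest S i = sorted_list_of_set S ! (i - 1)"

text \<open>The copy is the image of \<open>H\<close> under the injection \<open>f\<close>.\<close>

definition contains_in_color ::
  "nat \<Rightarrow> edge_coloring \<Rightarrow> color \<Rightarrow> 'a ordering \<Rightarrow> bool" where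
  "contains_in_color n c q H \<longleftrightarrow>
     (\<exists>f. inj_on f (verts (graph H)) \<and> f ` verts (graph H) \<subseteq> {1..n} \<and>
       (\<forall>e\<in>edges (graph H). c (f ` e) = q) \<and>
       (\<forall>i\<in>{1..card (verts (graph H))}. \<forall>v\<in>verts (graph H).
          f v = ith_smallest (f ` verts (graph H)) i \<longrightarrow> label H v \<in> {Some i, None}))"

text \<open>The value is \<open>\<infinity>\<close> if no such \<open>n\<close> exists.\<close>

definition ordered_ramsey :: "'a ordering \<Rightarrow> enat" where
  "ordered_ramsey H =
     Inf (enat ` {n. \<forall>c :: edge_coloring. \<exists>q. contains_in_color n c q H})"

datatype star_vertex = S1 | S2 | S3 | S4

definition four_star :: "star_vertex ugraph" where
  "four_star = \<lparr>verts = {S1, S2, S3, S4}, edges = {{S1, S2}, {S2, S3}, {S2, S4}}\<rparr>"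

lemma is_k_ordering_four_star: "is_k_ordering 1 (single_ordering four_star S1 1)"
  by (auto simp: is_k_ordering_def finite_simple_graph_def single_ordering_def four_star_def)

end

theory Submission
  imports Defs
begin

text \<open>Upper bound: by pigeonhole, the last of six vertices has three neighbours in one colour, and
  all of them precede it, so the smallest one can play the role of the labelled leaf. Lower bound:
  colour \<open>K\<^sub>5\<close> by a 5-cycle and its complement; both colour classes are 2-regular, so neither
  contains a vertex of degree 3.\<close>

text \<open>The centre goes to \<open>b\<close>, the labelled leaf to \<open>a\<close>, the other
  leaves to \<open>x\<close> and \<open>y\<close>. The only label is 1 on \<open>S1\<close>, so the
  order condition reduces to \<open>a\<close> being the smallest vertex of the copy.\<close>

lemma contains_starI:
  fixes a x y b n :: nat
  assumes "1 \<le> a" "a < x" "x < y" "y < b" "b \<le> n"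
    and "c {a, b} = q" "c {x, b} = q" "c {y, b} = q"
  shows "contains_in_color n c q (single_ordering four_star S1 1)"
proof -
  define f where "f = case_star_vertex a b x y"
  have f: "f S1 = a" "f S2 = b" "f S3 = x" "f S4 = y"
    by (simp_all add: f_def)
  have "sorted_list_of_set {a, b, x, y} = sorted_list_of_set (set [a, x, y, b])"
    by (simp add: insert_commute)
  also have "\<dots> = [a, x, y, b]"
    using assms by (intro sorted_list_of_set.idem_if_sorted_distinct) auto
  \<comment> \<open>The sorted copy is a distinct list with \<open>a\<close> at its head, so
    \<open>a\<close> has rank 1 and no other.\<close>
  finally have first: "i = 1" if "i \<in> {1..4}" "a = ith_smallest {a, b, x, y} i" for i
    using that assms by (auto simp: ith_smallest_def nth_Cons split: nat.splits)
  have img: "f ` {S1, S2, S3, S4} = {a, b, x, y}"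
    by (simp add: f)
  have "inj_on f {S1, S2, S3, S4}"
    using assms by (simp add: f)
  moreover have "{a, b, x, y} \<subseteq> {1..n}"
    using assms by auto
  moreover have "c (f ` e) = q" if "e \<in> {{S1, S2}, {S2, S3}, {S2, S4}}" for e
    using that assms by (elim insertE emptyE) (simp_all add: f insert_commute)
  moreover have "[S1 \<mapsto> 1] v \<in> {Some i, None}"
    if "i \<in> {1..4}" "f v = ith_smallest {a, b, x, y} i" for i v
    using that first[of i] f by (cases "v = S1") auto
  ultimately show ?thesis
    unfolding contains_in_color_def single_ordering_def four_star_def
    by (intro exI[of _ f]) (simp add: img del: image_insert)
qed

lemma three_of_five_same_color:
  fixes g :: "nat \<Rightarrow> color"
  shows "\<exists>a x y q. 1 \<le> a \<and> a < x \<and> x < y \<and> y \<le> 5 \<and> g a = q \<and> g x = q \<and> g y = q"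
proof -
  \<comment> \<open>All ten increasing triples from 1 to 5 are listed, which leaves a check of the
    32 colour patterns.\<close>
  have "\<exists>(a, x, y) \<in> {(1, 2, 3), (1, 2, 4), (1, 2, 5), (1, 3, 4), (1, 3, 5), (1, 4, 5),
      (2, 3, 4), (2, 3, 5), (2, 4, 5), (3, 4, 5)}. g a = g x \<and> g x = g y"
    by (cases "g 1"; cases "g 2"; cases "g 3"; cases "g 4"; cases "g 5") simp_all
  then obtain a x y where "(a, x, y) \<in> {(1, 2, 3), (1, 2, 4), (1, 2, 5), (1, 3, 4), (1, 3, 5),
      (1, 4, 5), (2, 3, 4), (2, 3, 5), (2, 4, 5), (3, 4, 5)}" "g a = g x" "g x = g y"
    by blast
  moreover from this(1) have "1 \<le> a \<and> a < x \<and> x < y \<and> y \<le> 5"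
    by auto
  ultimately show ?thesis
    by metis
qed

definition pentagon_coloring :: edge_coloring where
  "pentagon_coloring e =
     (if e \<in> {{1, 2}, {2, 3}, {3, 4}, {4, 5}, {1, 5}} then Red else Blue)"

text \<open>With vertices numbered from 1, the Red formulas are the cyclic successor and predecessor
  of \<open>b\<close>; the Blue ones are the two vertices at cyclic distance 2. The condition
  \<open>k \<noteq> b\<close> excludes the singleton \<open>{b}\<close>, which is coloured
  Blue.\<close>

lemma pentagon_coloring_neighbours:
  assumes "b \<in> {1, 2, 3, 4, 5}" "k \<in> {1, 2, 3, 4, 5}" "k \<noteq> b" "pentagon_coloring {b, k} = q"
  shows "k \<in> (case q of Red \<Rightarrow> {b mod 5 + 1, (b + 3) mod 5 + 1}
                    | Blue \<Rightarrow> {(b + 1) mod 5 + 1, (b + 2) mod 5 + 1})"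
proof -
  have "\<forall>b \<in> {1, 2, 3, 4, 5}. \<forall>k \<in> {1, 2, 3, 4, 5}. k \<noteq> b \<longrightarrow>
      k \<in> (case pentagon_coloring {b, k} of Red \<Rightarrow> {b mod 5 + 1, (b + 3) mod 5 + 1}
                    | Blue \<Rightarrow> {(b + 1) mod 5 + 1, (b + 2) mod 5 + 1})"
    by (simp add: pentagon_coloring_def doubleton_eq_iff)
  then show ?thesis
    using assms by blast
qed

text \<open>The image of the centre would have three distinct neighbours in colour \<open>q\<close>,
  but both colours offer at most two. All \<open>n \<le> 5\<close> are covered because the infimum
  requires excluding each of them.\<close>

lemma pentagon_coloring_avoids_star:
  assumes "n \<le> 5"
  shows "\<not> contains_in_color n pentagon_coloring q (single_ordering four_star S1 1)"
proof
  assume "contains_in_color n pentagon_coloring q (single_ordering four_star S1 1)"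
  then obtain f where inj: "inj_on f {S1, S2, S3, S4}" and ran: "f ` {S1, S2, S3, S4} \<subseteq> {1..n}"
    and col: "\<forall>e\<in>{{S1, S2}, {S2, S3}, {S2, S4}}. pentagon_coloring (f ` e) = q"
    unfolding contains_in_color_def by (auto simp: single_ordering_def four_star_def)
  define a b x y where "a = f S1" and "b = f S2" and "x = f S3" and "y = f S4"
  have dist: "a \<noteq> b" "a \<noteq> x" "a \<noteq> y" "b \<noteq> x" "b \<noteq> y" "x \<noteq> y"
    using inj by (auto simp: a_def b_def x_def y_def)
  have five: "k \<in> {1, 2, 3, 4, 5}" if "k \<in> {1..n}" for k
    using that assms by auto
  have mem: "a \<in> {1, 2, 3, 4, 5}" "b \<in> {1, 2, 3, 4, 5}" "x \<in> {1, 2, 3, 4, 5}" "y \<in> {1, 2, 3, 4, 5}"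
    using ran by (auto simp only: a_def b_def x_def y_def intro!: five)
  have "pentagon_coloring {b, a} = q" "pentagon_coloring {b, x} = q" "pentagon_coloring {b, y} = q"
    using col by (simp_all add: a_def b_def x_def y_def insert_commute)
  then have "{a, x, y} \<subseteq> (case q of Red \<Rightarrow> {b mod 5 + 1, (b + 3) mod 5 + 1}
                    | Blue \<Rightarrow> {(b + 1) mod 5 + 1, (b + 2) mod 5 + 1})" (is "_ \<subseteq> ?B")
    using mem dist pentagon_coloring_neighbours[of b _ q] by (metis insert_subset empty_subsetI)
  moreover have "finite ?B" "card ?B \<le> 2"
    by (auto split: color.split simp: card_insert_if)
  moreover have "card {a, x, y} = 3"
    using dist by simp
  ultimately show False
    using card_mono[of ?B "{a, x, y}"] by linarith
qed

theorem theorem3p4: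
  shows "ordered_ramsey (single_ordering four_star S1 1) = 6"
proof -
  let ?H = "single_ordering four_star S1 1"
  let ?N = "{n. \<forall>c :: edge_coloring. \<exists>q. contains_in_color n c q ?H}"
  have "\<exists>q. contains_in_color 6 c q ?H" for c
  proof -
    obtain a x y q where "1 \<le> a" "a < x" "x < y" "y \<le> 5"
      "c {a, 6} = q" "c {x, 6} = q" "c {y, 6} = q"
      \<comment> \<open>The edges from vertex 6 are read as a colouring of the vertices 1 to
        5.\<close>
      using three_of_five_same_color[of "\<lambda>k. c {k, 6}"] by blast
    then show ?thesis
      using contains_starI[of a x y 6 6 c q] by auto
  qed
  then have "Inf (enat ` ?N) \<le> enat 6"
    by (intro Inf_lower) auto
  moreover have "enat 6 \<le> Inf (enat ` ?N)"
  \<comment> \<open>Each member of \<open>?N\<close> is tested against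
    \<open>pentagon_coloring\<close>, which forces it above 5.\<close>
  proof (rule Inf_greatest)
    fix m
    assume "m \<in> enat ` ?N"
    then obtain n where "m = enat n" "\<exists>q. contains_in_color n pentagon_coloring q ?H"
      by auto
    then show "enat 6 \<le> m"
      using pentagon_coloring_avoids_star[of n] by (cases "n \<le> 5") auto
  qed
  ultimately show ?thesis
    by (simp add: ordered_ramsey_def numeral_eq_enat)
qed

end
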